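(* Let $\mathcal{H}$ be a complex Hilbert space, $A\in\mathcal{B}(\mathcal{H})$ a positive operator, and $T,S\in\mathcal{B}_{A^{1/2}}(\mathcal{H})$. Then $$r_A(TS)\leq\frac14\left(\omega_A(TS)+\omega_A(ST)+\sqrt{\left[\omega_A(TS)-\omega_A(ST)\right]^2+4\nu(T,S)}\right),$$ where $\nu(T,S)=\min\{\|T\|_A\|STS\|_A,\ \|S\|_A\|TST\|_A\}$.
   Context: $\mathcal{B}(\mathcal{H})$ is the algebra of bounded linear operators on the complex Hilbert space $(\mathcal{H},\langle\cdot\mid\cdot\rangle)$. For positive $A$, put $\langle x\mid y\rangle_A=\langle Ax\mid y\rangle$ and $\|x\|_A=\langle x\mid x\rangle_A^{1/2}=\|A^{1/2}x\|$. $\mathcal{B}_{A^{1/2}}(\mathcal{H})$ is the set of $T\in\mathcal{B}(\mathcal{H})$ for which there is $\lambda>0$ with $\|Tx\|_A\le\lambda\|x\|_A$ for all $x\in\mathcal{H}$ ($A$-bounded operators). For such $T$, $\|T\|_A=\sup\{\|Tx\|_A: x\in\mathcal{H},\ \|x\|_A=1\}$, the $A$-numerical radius is $\omega_A(T)=\sup\{|\langle Tx\mid x\rangle_A|: x\in\mathcal{H},\ \|x\|_A=1\}$ (suprema over the empty set, occurring only if $A=0$, are $0$), and the $A$-spectral radius is $r_A(T)=\inf_{n\ge1}\|T^n\|_A^{1/n}=\lim_{n\to\infty}\|T^n\|_A^{1/n}$. *)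

theory Defs
  imports "HOL-Analysis.Analysis"
begin

text \<open>
  The distribution has real inner product spaces only. The real normed structure is kept as a
  superclass, so that \<open>bounded_linear\<close>, completeness etc. are the library notions, and it is
  tied to the complex structure by \<open>scaleR_scaleC\<close> and \<open>norm_eq_sqrt_cinner\<close>.
  The inner product is linear in its first argument.
\<close>

class chilbert_space = banach +
  fixes scaleC :: "complex \<Rightarrow> 'a \<Rightarrow> 'a" (infixr "*\<^sub>C" 75)
    and cinner :: "'a \<Rightarrow> 'a \<Rightarrow> complex"
  assumes scaleC_add_right: "c *\<^sub>C (x + y) = c *\<^sub>C x + c *\<^sub>C y"
    and scaleC_add_left: "(c + d) *\<^sub>C x = c *\<^sub>C x + d *\<^sub>C x"
    and scaleC_scaleC: "c *\<^sub>C d *\<^sub>C x = (c * d) *\<^sub>C x"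
    and scaleC_one: "1 *\<^sub>C x = x"
    and scaleR_scaleC: "r *\<^sub>R x = complex_of_real r *\<^sub>C x"
    and cinner_commute: "cinner x y = cnj (cinner y x)"
    and cinner_add_left: "cinner (x + y) z = cinner x z + cinner y z"
    and cinner_scaleC_left: "cinner (c *\<^sub>C x) y = c * cinner x y"
    and cinner_self_nonneg: "0 \<le> Re (cinner x x)"
    and cinner_eq_zero_iff: "cinner x x = 0 \<longleftrightarrow> x = 0"
    and norm_eq_sqrt_cinner: "norm x = sqrt (Re (cinner x x))"

instantiation complex :: chilbert_space
begin

definition scaleC_complex :: "complex \<Rightarrow> complex \<Rightarrow> complex"
  where "scaleC_complex c x = c * x"

definition cinner_complex :: "complex \<Rightarrow> complex \<Rightarrow> complex"
  where "cinner_complex x y = x * cnj y"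

instance
  by standard
    (auto simp: scaleC_complex_def cinner_complex_def scaleR_conv_of_real cmod_def
      power2_eq_square algebra_simps)

end

definition cbounded_linear :: "('a::chilbert_space \<Rightarrow> 'a) \<Rightarrow> bool"
  where "cbounded_linear T \<longleftrightarrow> bounded_linear T \<and> (\<forall>c x. T (c *\<^sub>C x) = c *\<^sub>C T x)"

definition positive_op :: "('a::chilbert_space \<Rightarrow> 'a) \<Rightarrow> bool"
  where "positive_op A \<longleftrightarrow>
    cbounded_linear A \<and> (\<forall>x. cinner (A x) x \<in> \<real> \<and> 0 \<le> Re (cinner (A x) x))"

definition A_inner :: "('a::chilbert_space \<Rightarrow> 'a) \<Rightarrow> 'a \<Rightarrow> 'a \<Rightarrow> complex"
  where "A_inner A x y = cinner (A x) y"

definition A_norm :: "('a::chilbert_space \<Rightarrow> 'a) \<Rightarrow> 'a \<Rightarrow> real"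
  where "A_norm A x = sqrt (Re (A_inner A x x))"

definition A_bounded :: "('a::chilbert_space \<Rightarrow> 'a) \<Rightarrow> ('a \<Rightarrow> 'a) \<Rightarrow> bool"
  where "A_bounded A T \<longleftrightarrow>
    cbounded_linear T \<and> (\<exists>K>0. \<forall>x. A_norm A (T x) \<le> K * A_norm A x)"

definition A_unit_sphere :: "('a::chilbert_space \<Rightarrow> 'a) \<Rightarrow> 'a set"
  where "A_unit_sphere A = {x. A_norm A x = 1}"

text \<open>
  The supremum of the empty set is 0 by convention (needed if \<open>A = 0\<close>); for type \<open>real\<close>
  the library leaves it unspecified.
\<close>

definition A_opnorm :: "('a::chilbert_space \<Rightarrow> 'a) \<Rightarrow> ('a \<Rightarrow> 'a) \<Rightarrow> real"
  where "A_opnorm A T =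
    (if A_unit_sphere A = {} then 0 else SUP x\<in>A_unit_sphere A. A_norm A (T x))"

definition A_numerical_radius :: "('a::chilbert_space \<Rightarrow> 'a) \<Rightarrow> ('a \<Rightarrow> 'a) \<Rightarrow> real"
  where "A_numerical_radius A T =
    (if A_unit_sphere A = {} then 0 else SUP x\<in>A_unit_sphere A. cmod (A_inner A (T x) x))"

definition A_spectral_radius :: "('a::chilbert_space \<Rightarrow> 'a) \<Rightarrow> ('a \<Rightarrow> 'a) \<Rightarrow> real"
  where "A_spectral_radius A T = (INF n\<in>{1::nat..}. root n (A_opnorm A (T ^^ n)))"

definition nu :: "('a::chilbert_space \<Rightarrow> 'a) \<Rightarrow> ('a \<Rightarrow> 'a) \<Rightarrow> ('a \<Rightarrow> 'a) \<Rightarrow> real"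
  where "nu A T S =
    min (A_opnorm A T * A_opnorm A (S \<circ> T \<circ> S)) (A_opnorm A S * A_opnorm A (T \<circ> S \<circ> T))"

end

theory Submission
  imports Defs
begin

text \<open>
  Write \<open>T\<^sub>1 S\<^sub>1 + T\<^sub>2 S\<^sub>2 = V W\<close> with the row \<open>V = (T\<^sub>1 T\<^sub>2)\<close> and the column \<open>W = (S\<^sub>1 S\<^sub>2)\<close>. Since
  \<open>(V W)\<^sup>n\<^sup>+\<^sup>1 = V (W V)\<^sup>n W\<close>, its spectral radius is at most the numerical radius of the
  \<open>2 \<times> 2\<close> block operator \<open>W V\<close> with entries \<open>S\<^sub>i T\<^sub>j\<close>; this uses the power inequality for the
  exponents \<open>2\<^sup>k\<close> only. The numerical radius of \<open>W V\<close> is dominated by that of a \<open>2 \<times> 2\<close> real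
  matrix, whose off-diagonal entries are balanced by replacing \<open>T\<^sub>1, S\<^sub>1\<close> by \<open>t T\<^sub>1, t\<^sup>-\<^sup>1 S\<^sub>1\<close>.
  The choices \<open>(T, TS; S, I)\<close> and \<open>(T, I; S, TS)\<close> both make the sum equal to \<open>2 T S\<close> and give
  the two terms of the minimum.
\<close>

section \<open>The semi-inner product of a positive operator\<close>

lemma A_norm_nonneg [simp]: "positive_op A \<Longrightarrow> 0 \<le> A_norm A x"
  by (simp add: A_norm_def A_inner_def positive_op_def)

lemma cinner_add_right: "cinner x (y + z) = cinner x y + cinner x z"
  by (metis cinner_add_left cinner_commute complex_cnj_add)

lemma cinner_scaleC_right: "cinner x (c *\<^sub>C y) = cnj c * cinner x y"
  by (metis cinner_commute cinner_scaleC_left complex_cnj_mult)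

lemma A_inner_add_right: "A_inner A x (y + z) = A_inner A x y + A_inner A x z"
  by (simp add: A_inner_def cinner_add_right)

lemma A_inner_scaleC_right: "A_inner A x (c *\<^sub>C y) = cnj c * A_inner A x y"
  by (simp add: A_inner_def cinner_scaleC_right)

section \<open>Bounded complex-linear operators\<close>

lemma cbounded_linear_add: "cbounded_linear T \<Longrightarrow> T (x + y) = T x + T y"
  by (simp add: cbounded_linear_def linear_simps)

lemma cbounded_linear_scaleC: "cbounded_linear T \<Longrightarrow> T (c *\<^sub>C x) = c *\<^sub>C T x"
  by (simp add: cbounded_linear_def)

lemma cbounded_linear_id: "cbounded_linear (\<lambda>x. x)"
  by (simp add: cbounded_linear_def bounded_linear_ident)

lemma cbounded_linear_compose:
  "cbounded_linear T \<Longrightarrow> cbounded_linear S \<Longrightarrow> cbounded_linear (\<lambda>x. T (S x))"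
  by (simp add: cbounded_linear_def bounded_linear_compose)

lemma cbounded_linear_funpow: "cbounded_linear T \<Longrightarrow> cbounded_linear (T ^^ n)"
proof (induction n)
  case 0
  then show ?case using cbounded_linear_id by (simp add: id_def)
next
  case (Suc n)
  then show ?case using cbounded_linear_compose by (simp add: comp_def)
qed

lemma scaleC_commute: "c *\<^sub>C (d *\<^sub>C x) = d *\<^sub>C (c *\<^sub>C x)"
  by (simp add: scaleC_scaleC mult.commute)

lemma bounded_linear_scaleC: "bounded_linear (\<lambda>x. c *\<^sub>C x)"
proof (rule bounded_linear_intro[where K="cmod c"])
  fix x y :: 'a and r :: real
  show "c *\<^sub>C (x + y) = c *\<^sub>C x + c *\<^sub>C y"
    by (rule scaleC_add_right)
  show "c *\<^sub>C (r *\<^sub>R x) = r *\<^sub>R (c *\<^sub>C x)"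
    by (simp add: scaleR_scaleC scaleC_commute)
  have "cinner (c *\<^sub>C x) (c *\<^sub>C x) = complex_of_real ((cmod c)\<^sup>2) * cinner x x"
    by (simp only: cinner_scaleC_left cinner_scaleC_right complex_norm_square mult_ac)
  then have "Re (cinner (c *\<^sub>C x) (c *\<^sub>C x)) = (cmod c)\<^sup>2 * Re (cinner x x)"
    by (simp del: of_real_power)
  then show "norm (c *\<^sub>C x) \<le> norm x * cmod c"
    by (simp add: norm_eq_sqrt_cinner[where 'a='a] real_sqrt_mult mult.commute)
qed

lemma cbounded_linear_scaled:
  "cbounded_linear T \<Longrightarrow> cbounded_linear (\<lambda>x. c *\<^sub>C T x)"
  using bounded_linear_compose[OF bounded_linear_scaleC[of c]]
  by (auto simp: cbounded_linear_def scaleC_commute)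

context
  fixes A :: "'a::chilbert_space \<Rightarrow> 'a"
  assumes pos: "positive_op A"
begin

lemma A_inner_add_left: "A_inner A (x + y) z = A_inner A x z + A_inner A y z"
  using pos by (simp add: A_inner_def positive_op_def cbounded_linear_add cinner_add_left)

lemma A_inner_scaleC_left: "A_inner A (c *\<^sub>C x) y = c * A_inner A x y"
  using pos by (simp add: A_inner_def positive_op_def cbounded_linear_scaleC cinner_scaleC_left)

lemmas A_inner_simps =
  A_inner_add_left A_inner_add_right A_inner_scaleC_left A_inner_scaleC_right

lemma A_inner_self: "A_inner A x x = complex_of_real ((A_norm A x)\<^sup>2)"
  using pos by (auto simp: A_norm_def A_inner_def positive_op_def)

text \<open>On a complex space, real values on the diagonal force Hermitian symmetry: realness at
  \<open>x + y\<close> settles the imaginary parts, realness at \<open>x + \<i> *\<^sub>C y\<close>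
  the real parts.\<close>

lemma A_inner_commute: "A_inner A x y = cnj (A_inner A y x)"
proof -
  have im: "Im (A_inner A z z) = 0" for z
    by (simp add: A_inner_self)
  show ?thesis
    using im[of "x + y"] im[of "x + \<i> *\<^sub>C y"] im[of x] im[of y]
    by (simp add: A_inner_simps complex_eq_iff)
qed

lemma A_norm_scaleC: "A_norm A (c *\<^sub>C x) = cmod c * A_norm A x"
proof -
  have "complex_of_real ((A_norm A (c *\<^sub>C x))\<^sup>2) = A_inner A (c *\<^sub>C x) (c *\<^sub>C x)"
    by (rule A_inner_self[symmetric])
  also have "\<dots> = c * cnj c * A_inner A x x"
    by (simp add: A_inner_simps)
  also have "\<dots> = complex_of_real ((cmod c)\<^sup>2) * complex_of_real ((A_norm A x)\<^sup>2)"
    by (simp only: complex_norm_square A_inner_self)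
  also have "\<dots> = complex_of_real ((cmod c * A_norm A x)\<^sup>2)"
    by (simp add: power_mult_distrib)
  finally have "(A_norm A (c *\<^sub>C x))\<^sup>2 = (cmod c * A_norm A x)\<^sup>2"
    by (simp only: of_real_eq_iff)
  then show ?thesis
    by (rule power2_eq_imp_eq) (simp_all add: pos)
qed

lemma A_norm_add_power2:
  "(A_norm A (x + y))\<^sup>2 = (A_norm A x)\<^sup>2 + 2 * Re (A_inner A x y) + (A_norm A y)\<^sup>2"
proof -
  have "(A_norm A (x + y))\<^sup>2 = Re (A_inner A (x + y) (x + y))"
    by (simp only: A_inner_self Re_complex_of_real)
  also have "\<dots> = Re (complex_of_real ((A_norm A x)\<^sup>2) + A_inner A x y
      + A_inner A y x + complex_of_real ((A_norm A y)\<^sup>2))"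
    by (simp only: A_inner_self[of x, symmetric] A_inner_self[of y, symmetric])
      (simp add: A_inner_simps)
  also have "\<dots> = (A_norm A x)\<^sup>2 + 2 * Re (A_inner A x y) + (A_norm A y)\<^sup>2"
    using A_inner_commute[of y x] by simp
  finally show ?thesis .
qed

text \<open>Serves to replace a modulus by the real part of a rotated expression, to which
  positivity applies.\<close>

lemma exists_unit_rotation: "\<exists>u. cmod u = 1 \<and> u * z = complex_of_real (cmod z)"
proof (cases "z = 0")
  case True
  then show ?thesis by (intro exI[of _ 1]) simp
next
  case False
  have "z * cnj z = complex_of_real (cmod z) * complex_of_real (cmod z)"
    by (metis complex_norm_square of_real_mult power2_eq_square)
  then show ?thesis
    using False by (intro exI[of _ "cnj z / cmod z"]) (simp add: norm_divide field_simps)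
qed

text \<open>Discriminant argument: once \<open>x\<close> is rotated so that the mixed term is real,
  the squared seminorm along a real line in direction \<open>y\<close> is a nonnegative quadratic.
  The seminorm may vanish at a nonzero \<open>y\<close>, and then the quadratic loses its leading
  term, hence the case distinction.\<close>

lemma A_Cauchy_Schwarz: "cmod (A_inner A x y) \<le> A_norm A x * A_norm A y"
proof -
  obtain u where u: "cmod u = 1" "u * A_inner A x y = complex_of_real (cmod (A_inner A x y))"
    using exists_unit_rotation by blast
  define p q c where "p = A_norm A x" and "q = A_norm A y" and "c = cmod (A_inner A x y)"
  have quad: "0 \<le> p\<^sup>2 + 2 * t * c + t\<^sup>2 * q\<^sup>2" for t :: real
  proof -
    have "A_inner A (u *\<^sub>C x) (complex_of_real t *\<^sub>C y) = complex_of_real (t * c)"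
      by (subst A_inner_scaleC_right, subst A_inner_scaleC_left, subst u(2)) (simp add: c_def)
    then have "(A_norm A (u *\<^sub>C x + complex_of_real t *\<^sub>C y))\<^sup>2 = p\<^sup>2 + 2 * t * c + t\<^sup>2 * q\<^sup>2"
      by (simp add: A_norm_add_power2 A_norm_scaleC u(1) p_def q_def power_mult_distrib)
    then show ?thesis
      by (metis zero_le_power2)
  qed
  have "p\<^sup>2 * q\<^sup>2 \<ge> c\<^sup>2"
  proof (cases "q = 0")
    case True
    have "c = 0"
    proof (rule ccontr)
      assume "c \<noteq> 0"
      \<comment> \<open>At this \<open>t\<close> the affine function
        \<open>p\<^sup>2 + 2 * t * c\<close> takes the value -1.\<close>
      then show False
        using quad[of "- (p\<^sup>2 + 1) / (2 * c)"] True by (simp add: field_simps)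
    qed
    then show ?thesis by simp
  next
    case False
    \<comment> \<open>The point \<open>- c / q\<^sup>2\<close> is the minimiser of the
      quadratic.\<close>
    then have "p\<^sup>2 + 2 * (- c / q\<^sup>2) * c + (- c / q\<^sup>2)\<^sup>2 * q\<^sup>2 = p\<^sup>2 - c\<^sup>2 / q\<^sup>2"
      by (simp add: field_simps power2_eq_square)
    then have "c\<^sup>2 / q\<^sup>2 \<le> p\<^sup>2"
      using quad[of "- c / q\<^sup>2"] by linarith
    then show ?thesis
      using False by (simp add: divide_le_eq)
  qed
  then have "c\<^sup>2 \<le> (p * q)\<^sup>2"
    by (simp add: power_mult_distrib)
  then show ?thesis
    unfolding c_def p_def q_def by (rule power2_le_imp_le) (simp add: pos)
qed

lemma A_norm_triangle: "A_norm A (x + y) \<le> A_norm A x + A_norm A y"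
proof (rule power2_le_imp_le)
  have "Re (A_inner A x y) \<le> A_norm A x * A_norm A y"
    using A_Cauchy_Schwarz[of x y] complex_Re_le_cmod order_trans by blast
  then show "(A_norm A (x + y))\<^sup>2 \<le> (A_norm A x + A_norm A y)\<^sup>2"
    by (simp add: A_norm_add_power2 power2_sum)
qed (use pos in simp)

section \<open>Numerical bounds and powers\<close>

text \<open>Polarization over the fourth roots of unity \<open>c\<close>: when the bounds at the
  four vectors \<open>x + c *\<^sub>C y\<close> are added, their mixed terms cancel as in the
  parallelogram law.\<close>

lemma A_inner_polarization:
  assumes T: "cbounded_linear T"
    and w: "\<And>x. cmod (A_inner A (T x) x) \<le> w * (A_norm A x)\<^sup>2"
  shows "cmod (A_inner A (T x) y) \<le> w * ((A_norm A x)\<^sup>2 + (A_norm A y)\<^sup>2)"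
proof -
  define f where "f c = A_inner A (T (x + c *\<^sub>C y)) (x + c *\<^sub>C y)" for c
  have f: "f c = A_inner A (T x) x + cnj c * A_inner A (T x) y + c * A_inner A (T y) x
      + c * cnj c * A_inner A (T y) y" for c
    by (simp add: f_def cbounded_linear_add[OF T] cbounded_linear_scaleC[OF T] A_inner_simps
        algebra_simps)
  have eq: "4 * A_inner A (T x) y = f 1 + \<i> * f \<i> - f (- 1) - \<i> * f (- \<i>)"
    by (simp add: f algebra_simps)
  have bound: "cmod (f c) \<le> w * ((A_norm A x)\<^sup>2 + 2 * Re (cnj c * A_inner A x y) + (A_norm A y)\<^sup>2)"
    if "cmod c = 1" for c
    using w[of "x + c *\<^sub>C y"] that
    by (simp add: f_def A_norm_add_power2 A_norm_scaleC A_inner_simps power_mult_distrib)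
  have "4 * cmod (A_inner A (T x) y) = cmod (f 1 + \<i> * f \<i> - f (- 1) - \<i> * f (- \<i>))"
    by (simp flip: eq add: norm_mult)
  also have "\<dots> \<le> cmod (f 1) + cmod (f \<i>) + cmod (f (- 1)) + cmod (f (- \<i>))"
    using norm_triangle_ineq4[of "f 1 + \<i> * f \<i> - f (- 1)" "\<i> * f (- \<i>)"]
      norm_triangle_ineq4[of "f 1 + \<i> * f \<i>" "f (- 1)"] norm_triangle_ineq[of "f 1" "\<i> * f \<i>"]
    by (simp add: norm_mult)
  also have "\<dots> \<le> 4 * (w * ((A_norm A x)\<^sup>2 + (A_norm A y)\<^sup>2))"
    using bound[of 1] bound[of \<i>] bound[of "- 1"] bound[of "- \<i>"]
    by (simp add: algebra_simps)
  finally show ?thesis by simp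
qed

text \<open>Polarization with a positive multiple \<open>s\<close> of \<open>T x\<close> in place of
  \<open>y\<close>; optimising over \<open>s\<close> yields the classical constant 2 between norm
  and numerical radius.\<close>

lemma A_norm_le_twice_numerical_bound:
  assumes T: "cbounded_linear T" and "0 \<le> w"
    and w: "\<And>x. cmod (A_inner A (T x) x) \<le> w * (A_norm A x)\<^sup>2"
  shows "A_norm A (T x) \<le> 2 * w * A_norm A x"
proof -
  define p q where "p = A_norm A x" and "q = A_norm A (T x)"
  have ineq: "s * q\<^sup>2 \<le> w * (p\<^sup>2 + s\<^sup>2 * q\<^sup>2)" if "0 < s" for s :: real
    using A_inner_polarization[OF T w, of x "complex_of_real s *\<^sub>C T x"] that
    by (simp add: A_inner_simps A_inner_self A_norm_scaleC norm_mult power_mult_distrib p_def q_def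
        del: of_real_power)
  have "q\<^sup>2 \<le> (2 * w * p)\<^sup>2"
  proof (cases "w = 0")
    case True
    then show ?thesis using ineq[of 1] by simp
  next
    case False
    \<comment> \<open>This \<open>s\<close> maximises \<open>s - w * s\<^sup>2\<close>, the
      coefficient of \<open>q\<^sup>2\<close> after collecting terms.\<close>
    then show ?thesis
      using ineq[of "1 / (2 * w)"] \<open>0 \<le> w\<close> by (simp add: field_simps power2_eq_square)
  qed
  then show ?thesis
    unfolding p_def q_def by (rule power2_le_imp_le) (simp add: pos \<open>0 \<le> w\<close>)
qed

text \<open>
  With \<open>x\<^sub>\<plusminus> = w x \<plusminus> \<theta> T x\<close> one has \<open>(w\<^sup>2 - \<theta>\<^sup>2 T\<^sup>2) x = (w \<mp> \<theta> T) x\<^sub>\<plusminus>\<close> and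
  \<open>x\<^sub>+ + x\<^sub>- = 2 w x\<close>, so positivity of the real parts of \<open>w \<mp> \<theta> T\<close> passes to
  \<open>w\<^sup>2 - \<theta>\<^sup>2 T\<^sup>2\<close>.
\<close>
lemma numerical_bound_square:
  assumes T: "cbounded_linear T" and "0 \<le> w"
    and w: "\<And>x. cmod (A_inner A (T x) x) \<le> w * (A_norm A x)\<^sup>2"
  shows "cmod (A_inner A (T (T x)) x) \<le> w\<^sup>2 * (A_norm A x)\<^sup>2"
proof (cases "w = 0")
  case True
  \<comment> \<open>The other case ends with a cancellation of the factor \<open>w\<close>, so
    \<open>w = 0\<close> is settled by the factor-two bound.\<close>
  then have "A_norm A (T (T x)) = 0"
    using A_norm_le_twice_numerical_bound[OF T _ w] pos by (metis A_norm_nonneg mult_zero_left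
        mult_zero_right order_antisym order_refl)
  then show ?thesis
    using A_Cauchy_Schwarz[of "T (T x)" x] True by simp
next
  case False
  obtain u where u: "cmod u = 1"
      "u * A_inner A (T (T x)) x = complex_of_real (cmod (A_inner A (T (T x)) x))"
    using exists_unit_rotation by blast
  \<comment> \<open>The rotation is split evenly over the two factors \<open>T\<close>: multiplying
    by \<open>th * th\<close> turns the form of \<open>T (T x)\<close> into its modulus.\<close>
  define th where "th = csqrt u"
  have th2: "th * th = u" by (simp add: th_def flip: power2_eq_square)
  have th: "cmod th = 1" using u by (simp add: th_def)
  have real_part: "0 \<le> Re (A_inner A (complex_of_real w *\<^sub>C y + c *\<^sub>C T y) y)" if "cmod c = 1" for c y
  proof -
    have "\<bar>Re (c * A_inner A (T y) y)\<bar> \<le> w * (A_norm A y)\<^sup>2"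
      using w[of y] abs_Re_le_cmod[of "c * A_inner A (T y) y"] that by (simp add: norm_mult)
    then show ?thesis
      by (simp add: A_inner_simps A_inner_self)
  qed
  define y where "y c = complex_of_real w *\<^sub>C x + c *\<^sub>C T x" for c
  have "0 \<le> Re (A_inner A (complex_of_real w *\<^sub>C y th + (- th) *\<^sub>C T (y th)) (y th)
      + A_inner A (complex_of_real w *\<^sub>C y (- th) + th *\<^sub>C T (y (- th))) (y (- th)))"
    using real_part[of "- th" "y th"] real_part[of th "y (- th)"] th by simp
  also have "\<dots> = 2 * w * Re (w\<^sup>2 * A_inner A x x - th * th * A_inner A (T (T x)) x)"
    by (simp add: y_def A_inner_simps cbounded_linear_add[OF T] cbounded_linear_scaleC[OF T]
        algebra_simps power2_eq_square)
  also have "\<dots> = 2 * w * (w\<^sup>2 * (A_norm A x)\<^sup>2 - cmod (A_inner A (T (T x)) x))"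
    unfolding th2 u A_inner_self by simp
  finally show ?thesis
    using False \<open>0 \<le> w\<close> by (simp add: zero_le_mult_iff)
qed

text \<open>Repeated squaring: the induction hypothesis is the numerical bound for
  \<open>T ^^ (2 ^ k)\<close>, to which the squaring lemma applies again.\<close>

lemma numerical_bound_dyadic_power:
  assumes T: "cbounded_linear T" and "0 \<le> w"
    and w: "\<And>x. cmod (A_inner A (T x) x) \<le> w * (A_norm A x)\<^sup>2"
  shows "cmod (A_inner A ((T ^^ (2 ^ k)) x) x) \<le> w ^ (2 ^ k) * (A_norm A x)\<^sup>2"
proof (induction k arbitrary: x)
  case 0
  then show ?case using w by simp
next
  case (Suc k)
  have "(T ^^ (2 ^ Suc k)) x = (T ^^ (2 ^ k)) ((T ^^ (2 ^ k)) x)"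
    by (metis comp_apply funpow_add mult_2 power_Suc)
  then show ?case
    using numerical_bound_square[OF cbounded_linear_funpow[OF T] _ Suc.IH] \<open>0 \<le> w\<close>
    by (simp add: power_mult mult.commute[of 2])
qed

section \<open>Operator seminorm, numerical radius and spectral radius\<close>

text \<open>Reduces homogeneous inequalities to the sphere on which the suprema are taken; null
  vectors of the seminorm always form a separate case.\<close>

lemma A_unit_sphere_normalize:
  assumes "A_norm A x \<noteq> 0"
  obtains y where "y \<in> A_unit_sphere A" "x = complex_of_real (A_norm A x) *\<^sub>C y"
proof
  show "complex_of_real (1 / A_norm A x) *\<^sub>C x \<in> A_unit_sphere A"
    using assms pos by (simp add: A_unit_sphere_def A_norm_scaleC norm_divide)
  show "x = complex_of_real (A_norm A x) *\<^sub>C complex_of_real (1 / A_norm A x) *\<^sub>C x"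
    using assms by (simp add: scaleC_scaleC scaleC_one)
qed

text \<open>A real \<open>SUP\<close> dominates the values only when they are bounded above. The
  second claim follows from the same constant by Cauchy-Schwarz.\<close>

lemma A_bounded_bdd_above:
  assumes "A_bounded A T"
  shows "bdd_above ((\<lambda>x. A_norm A (T x)) ` A_unit_sphere A)"
    and "bdd_above ((\<lambda>x. cmod (A_inner A (T x) x)) ` A_unit_sphere A)"
proof -
  obtain K where K: "\<And>x. A_norm A (T x) \<le> K * A_norm A x"
    using assms by (auto simp: A_bounded_def)
  show "bdd_above ((\<lambda>x. A_norm A (T x)) ` A_unit_sphere A)"
    using K by (intro bdd_aboveI2[where M=K]) (metis A_unit_sphere_def mem_Collect_eq mult_1_right)
  show "bdd_above ((\<lambda>x. cmod (A_inner A (T x) x)) ` A_unit_sphere A)"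
  proof (intro bdd_aboveI2[where M=K])
    fix x assume "x \<in> A_unit_sphere A"
    then show "cmod (A_inner A (T x) x) \<le> K"
      using K[of x] A_Cauchy_Schwarz[of "T x" x] by (simp add: A_unit_sphere_def)
  qed
qed

lemma A_opnorm_nonneg:
  assumes "A_bounded A T"
  shows "0 \<le> A_opnorm A T"
proof (cases "A_unit_sphere A = {}")
  case False
  then obtain x where "x \<in> A_unit_sphere A" by blast
  then have "A_norm A (T x) \<le> (SUP x\<in>A_unit_sphere A. A_norm A (T x))"
    using cSUP_upper A_bounded_bdd_above(1)[OF assms] by fast
  then show ?thesis
    using False order_trans[OF A_norm_nonneg[OF pos, of "T x"]] by (simp add: A_opnorm_def)
qed (simp add: A_opnorm_def)

lemma A_numerical_radius_nonneg:
  assumes "A_bounded A T"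
  shows "0 \<le> A_numerical_radius A T"
proof (cases "A_unit_sphere A = {}")
  case False
  then obtain x where "x \<in> A_unit_sphere A" by blast
  then have "cmod (A_inner A (T x) x) \<le> (SUP x\<in>A_unit_sphere A. cmod (A_inner A (T x) x))"
    using A_bounded_bdd_above(2)[OF assms] by (intro cSUP_upper)
  then show ?thesis
    using False norm_ge_zero[of "A_inner A (T x) x"]
    by (simp add: A_numerical_radius_def del: norm_ge_zero)
qed (simp add: A_numerical_radius_def)

lemma A_norm_le_A_opnorm:
  assumes "A_bounded A T"
  shows "A_norm A (T x) \<le> A_opnorm A T * A_norm A x"
proof (cases "A_norm A x = 0")
  case True
  \<comment> \<open>The supremum says nothing about null vectors; A-boundedness itself makes
    \<open>T\<close> map them to null vectors.\<close>
  then have "A_norm A (T x) \<le> 0"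
    using assms by (metis A_bounded_def mult_zero_right)
  then show ?thesis using True by simp
next
  case False
  then obtain y where y: "y \<in> A_unit_sphere A" "x = complex_of_real (A_norm A x) *\<^sub>C y"
    using A_unit_sphere_normalize by blast
  have "A_norm A (T x) = A_norm A x * A_norm A (T y)"
    using y(2) assms pos cbounded_linear_scaleC[of T "complex_of_real (A_norm A x)" y]
    by (metis A_bounded_def A_norm_nonneg A_norm_scaleC abs_of_nonneg norm_of_real)
  moreover have "A_norm A (T y) \<le> A_opnorm A T"
    using y(1) cSUP_upper[OF y(1) A_bounded_bdd_above(1)[OF assms]] by (auto simp: A_opnorm_def)
  ultimately show ?thesis
    using pos by (simp add: mult.commute mult_left_mono)
qed

lemma A_inner_le_A_numerical_radius:
  assumes "A_bounded A T"
  shows "cmod (A_inner A (T x) x) \<le> A_numerical_radius A T * (A_norm A x)\<^sup>2"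
proof (cases "A_norm A x = 0")
  case True
  then show ?thesis
    using A_Cauchy_Schwarz[of "T x" x] by simp
next
  case False
  then obtain y where y: "y \<in> A_unit_sphere A" "x = complex_of_real (A_norm A x) *\<^sub>C y"
    using A_unit_sphere_normalize by blast
  have "T x = complex_of_real (A_norm A x) *\<^sub>C T y"
    using y(2) assms cbounded_linear_scaleC by (metis A_bounded_def)
  then have "A_inner A (T x) x = complex_of_real ((A_norm A x)\<^sup>2) * A_inner A (T y) y"
    by (subst (2) y(2)) (simp add: A_inner_simps power2_eq_square)
  then have "cmod (A_inner A (T x) x) = cmod (A_inner A (T y) y) * (A_norm A x)\<^sup>2"
    by (simp add: norm_mult del: of_real_power)
  moreover have "cmod (A_inner A (T y) y) \<le> A_numerical_radius A T"
    using y(1) cSUP_upper[OF y(1) A_bounded_bdd_above(2)[OF assms]]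
    by (auto simp: A_numerical_radius_def)
  ultimately show ?thesis
    by (simp add: mult_right_mono)
qed

lemma A_opnorm_le:
  assumes "0 \<le> K" and "\<And>x. A_norm A (T x) \<le> K * A_norm A x"
  shows "A_opnorm A T \<le> K"
proof (cases "A_unit_sphere A = {}")
  case False
  then show ?thesis
    unfolding A_opnorm_def using assms(2)
    by (auto intro!: cSUP_least) (metis A_unit_sphere_def mem_Collect_eq mult_1_right)
\<comment> \<open>On an empty sphere the seminorm is 0 by convention, and this is where
  \<open>0 \<le> K\<close> enters.\<close>
qed (simp add: A_opnorm_def assms(1))

section \<open>Stability of A-boundedness under algebraic operations\<close>

lemma A_bounded_id: "A_bounded A (\<lambda>x. x)"
  by (auto simp: A_bounded_def cbounded_linear_id intro!: exI[of _ 1])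

lemma A_bounded_compose:
  assumes "A_bounded A T" "A_bounded A S"
  shows "A_bounded A (\<lambda>x. T (S x))"
proof -
  obtain K L where K: "K > 0" "\<And>x. A_norm A (T x) \<le> K * A_norm A x"
    and L: "L > 0" "\<And>x. A_norm A (S x) \<le> L * A_norm A x"
    using assms by (auto simp: A_bounded_def)
  have "A_norm A (T (S x)) \<le> (K * L) * A_norm A x" for x
    using order_trans[OF K(2)[of "S x"] mult_left_mono[OF L(2)[of x]]] K(1) by (simp add: mult.assoc)
  then show ?thesis
    using K(1) L(1) assms
    by (auto simp: A_bounded_def cbounded_linear_compose intro!: exI[of _ "K * L"])
qed

lemma A_bounded_scaled:
  assumes "A_bounded A T"
  shows "A_bounded A (\<lambda>x. c *\<^sub>C T x)"
proof -
  obtain K where K: "K > 0" "\<And>x. A_norm A (T x) \<le> K * A_norm A x"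
    using assms by (auto simp: A_bounded_def)
  \<comment> \<open>The summand 1 keeps the constant strictly positive even for
    \<open>c = 0\<close>.\<close>
  have "A_norm A (c *\<^sub>C T x) \<le> ((cmod c + 1) * K) * A_norm A x" for x
    using mult_mono[OF _ K(2)[of x], of "cmod c" "cmod c + 1"] pos
    by (simp add: A_norm_scaleC mult.assoc)
  moreover have "(cmod c + 1) * K > 0"
    using K(1) by (simp add: add_nonneg_pos)
  ultimately show ?thesis
    using assms by (auto simp: A_bounded_def cbounded_linear_scaled)
qed

lemma A_bounded_add:
  assumes "A_bounded A T" "A_bounded A S"
  shows "A_bounded A (\<lambda>x. T x + S x)"
proof -
  obtain K L where K: "K > 0" "\<And>x. A_norm A (T x) \<le> K * A_norm A x"
    and L: "L > 0" "\<And>x. A_norm A (S x) \<le> L * A_norm A x"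
    using assms by (auto simp: A_bounded_def)
  have "A_norm A (T x + S x) \<le> (K + L) * A_norm A x" for x
    using A_norm_triangle[of "T x" "S x"] K(2)[of x] L(2)[of x] by (simp add: algebra_simps)
  then show ?thesis
    using K(1) L(1) assms
    by (auto simp: A_bounded_def cbounded_linear_def bounded_linear_add scaleC_add_right
        intro!: exI[of _ "K + L"])
qed

lemma A_bounded_funpow: "A_bounded A T \<Longrightarrow> A_bounded A (T ^^ n)"
proof (induction n)
  case 0
  then show ?case using A_bounded_id by (simp add: id_def)
next
  case (Suc n)
  then show ?case using A_bounded_compose by (simp add: comp_def)
qed

text \<open>As an infimum, the spectral radius is controlled by any sequence of exponents, here
  \<open>Suc (2 ^ k)\<close>. The shift by one and the constant \<open>C\<close> have no effect in
  the limit.\<close>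

lemma A_spectral_radius_le:
  assumes R: "A_bounded A R" and "0 \<le> w" and "0 \<le> C"
    and bound: "\<And>k x. A_norm A ((R ^^ Suc (2 ^ k)) x) \<le> C * w ^ (2 ^ k) * A_norm A x"
  shows "A_spectral_radius A R \<le> w"
proof -
  define r where "r = A_spectral_radius A R"
  have nonneg: "0 \<le> root n (A_opnorm A (R ^^ n))" if "n \<in> {1..}" for n
    using that A_opnorm_nonneg[OF A_bounded_funpow[OF R]] by (simp add: real_root_ge_zero)
  have r0: "0 \<le> r"
    unfolding r_def A_spectral_radius_def using nonneg by (intro cINF_greatest) auto
  have upper: "r ^ Suc (2 ^ k) \<le> C * w ^ (2 ^ k)" for k
  proof -
    let ?n = "Suc (2 ^ k)"
    have "r \<le> root ?n (A_opnorm A (R ^^ ?n))"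
      unfolding r_def A_spectral_radius_def
      using nonneg by (intro cINF_lower bdd_belowI2[where m=0]) auto
    then have "r ^ ?n \<le> root ?n (A_opnorm A (R ^^ ?n)) ^ ?n"
      using r0 by (rule power_mono)
    also have "\<dots> = A_opnorm A (R ^^ ?n)"
      by (intro real_root_pow_pos2 A_opnorm_nonneg A_bounded_funpow R) simp
    also have "\<dots> \<le> C * w ^ (2 ^ k)"
      using assms(2,3) by (intro A_opnorm_le bound) simp
    finally show ?thesis .
  qed
  have "r \<le> w"
  proof (rule ccontr)
    assume "\<not> r \<le> w"
    then have "0 < r" and less: "w / r < 1" "0 \<le> w / r"
      using \<open>0 \<le> w\<close> by auto
    \<comment> \<open>Dividing by \<open>r ^ (2 ^ k)\<close> leaves a single factor \<open>r\<close>
      on the left, while the right side tends to 0 because \<open>w / r < 1\<close>.\<close>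
    have "r \<le> C * (w / r) ^ (2 ^ k)" for k
      using upper[of k] \<open>0 < r\<close> by (simp add: power_divide field_simps)
    moreover have "(\<lambda>k. C * (w / r) ^ (2 ^ k)) \<longlonglongrightarrow> C * 0"
    proof (intro tendsto_intros)
      have "strict_mono (\<lambda>k. 2 ^ k :: nat)"
        by (simp add: strict_mono_Suc_iff)
      then show "(\<lambda>k. (w / r) ^ (2 ^ k)) \<longlonglongrightarrow> 0"
        using LIMSEQ_subseq_LIMSEQ[OF LIMSEQ_realpow_zero[OF less(2,1)], of "\<lambda>k. 2 ^ k"]
        by (simp add: comp_def)
    qed
    ultimately have "r \<le> C * 0"
      by (intro LIMSEQ_le_const) auto
    then show False using \<open>0 < r\<close> by simp
  qed
  then show ?thesis by (simp add: r_def)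
qed

end

section \<open>The direct sum\<close>

text \<open>The orthogonal direct sum is the space on which the block operators act. The norm of
  pairs is already the Euclidean one, so completeness is inherited and only the complex structure is
  added.\<close>

instantiation prod :: (chilbert_space, chilbert_space) chilbert_space
begin

definition scaleC_prod :: "complex \<Rightarrow> 'a \<times> 'b \<Rightarrow> 'a \<times> 'b"
  where "scaleC_prod c z = (c *\<^sub>C fst z, c *\<^sub>C snd z)"

definition cinner_prod :: "'a \<times> 'b \<Rightarrow> 'a \<times> 'b \<Rightarrow> complex"
  where "cinner_prod y z = cinner (fst y) (fst z) + cinner (snd y) (snd z)"

instance
proof
  fix c d :: complex and r :: real and x y z :: "'a \<times> 'b"
  \<comment> \<open>Conjugate symmetry makes diagonal values real, so that the vanishing of their
    real parts below suffices.\<close>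
  have im: "Im (cinner a a) = 0" for a :: "'c::chilbert_space"
    using cinner_commute[of a a] by (simp add: complex_eq_iff)
  show "c *\<^sub>C (x + y) = c *\<^sub>C x + c *\<^sub>C y"
    by (simp add: scaleC_prod_def scaleC_add_right)
  show "(c + d) *\<^sub>C x = c *\<^sub>C x + d *\<^sub>C x"
    by (simp add: scaleC_prod_def scaleC_add_left)
  show "c *\<^sub>C d *\<^sub>C x = (c * d) *\<^sub>C x"
    by (simp add: scaleC_prod_def scaleC_scaleC)
  show "1 *\<^sub>C x = x"
    by (simp add: scaleC_prod_def scaleC_one)
  show "r *\<^sub>R x = complex_of_real r *\<^sub>C x"
    by (simp add: scaleC_prod_def scaleR_prod_def scaleR_scaleC)
  show "cinner x y = cnj (cinner y x)"
    by (simp add: cinner_prod_def cinner_commute[of "fst x"] cinner_commute[of "snd x"])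
  show "cinner (x + y) z = cinner x z + cinner y z"
    by (simp add: cinner_prod_def cinner_add_left)
  show "cinner (c *\<^sub>C x) y = c * cinner x y"
    by (simp add: cinner_prod_def scaleC_prod_def cinner_scaleC_left algebra_simps)
  show "0 \<le> Re (cinner x x)"
    by (simp add: cinner_prod_def cinner_self_nonneg)
  show "cinner x x = 0 \<longleftrightarrow> x = 0"
  proof
    assume "cinner x x = 0"
    then have "Re (cinner (fst x) (fst x)) + Re (cinner (snd x) (snd x)) = 0"
      by (simp add: cinner_prod_def complex_eq_iff)
    then have "Re (cinner (fst x) (fst x)) = 0" "Re (cinner (snd x) (snd x)) = 0"
      using cinner_self_nonneg[of "fst x"] cinner_self_nonneg[of "snd x"] by linarith+
    then have "cinner (fst x) (fst x) = 0" "cinner (snd x) (snd x) = 0"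
      by (simp_all add: complex_eq_iff im)
    then show "x = 0"
      by (simp add: cinner_eq_zero_iff prod_eq_iff)
  next
    assume "x = 0"
    then show "cinner x x = 0"
      by (simp add: cinner_prod_def cinner_eq_zero_iff[THEN iffD2])
  qed
  show "norm x = sqrt (Re (cinner x x))"
    by (simp add: norm_prod_def cinner_prod_def norm_eq_sqrt_cinner cinner_self_nonneg)
qed

end

text \<open>\<open>map_prod A B\<close> is the block-diagonal operator; with both blocks equal to
  \<open>A\<close> it carries the numerical bounds over to the direct sum.\<close>

lemma A_inner_map_prod:
  "A_inner (map_prod A B) y z = A_inner A (fst y) (fst z) + A_inner B (snd y) (snd z)"
  by (simp add: A_inner_def cinner_prod_def)

lemma positive_op_map_prod:
  assumes "positive_op A" "positive_op B"
  shows "positive_op (map_prod A B)"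
proof -
  have "bounded_linear (\<lambda>z. (A (fst z), B (snd z)))"
    using assms
    by (intro bounded_linear_Pair bounded_linear_compose[OF _ bounded_linear_fst]
        bounded_linear_compose[OF _ bounded_linear_snd])
      (auto simp: positive_op_def cbounded_linear_def)
  moreover have "map_prod A B = (\<lambda>z. (A (fst z), B (snd z)))"
    by (auto simp: fun_eq_iff)
  ultimately show ?thesis
    using assms
    by (auto simp: positive_op_def cbounded_linear_def scaleC_prod_def cinner_prod_def)
qed

lemma A_norm_map_prod:
  assumes "positive_op A" "positive_op B"
  shows "(A_norm (map_prod A B) z)\<^sup>2 = (A_norm A (fst z))\<^sup>2 + (A_norm B (snd z))\<^sup>2"
proof -
  have "complex_of_real ((A_norm (map_prod A B) z)\<^sup>2)
      = complex_of_real ((A_norm A (fst z))\<^sup>2 + (A_norm B (snd z))\<^sup>2)"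
    by (simp only: of_real_add A_inner_self[symmetric] assms positive_op_map_prod A_inner_map_prod)
  then show ?thesis by (simp only: of_real_eq_iff)
qed

section \<open>Sums of two products\<close>

text \<open>Here \<open>w\<close> is the larger eigenvalue of the symmetric matrix with diagonal
  \<open>a\<close>, \<open>d\<close> and off-diagonal entry \<open>e\<close>.\<close>

lemma quadratic_form_le:
  fixes a d e p q :: real
  defines "w \<equiv> (a + d + sqrt ((a - d)\<^sup>2 + 4 * e\<^sup>2)) / 2"
  shows "a * p\<^sup>2 + d * q\<^sup>2 + 2 * e * (p * q) \<le> w * (p\<^sup>2 + q\<^sup>2)"
proof -
  define s where "s = sqrt ((a - d)\<^sup>2 + 4 * e\<^sup>2)"
  have w: "w = (a + d + s) / 2" by (simp add: w_def s_def)
  have s2: "s\<^sup>2 = (a - d)\<^sup>2 + 4 * e\<^sup>2" by (simp add: s_def)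
  have "\<bar>a - d\<bar> \<le> s"
    unfolding s_def by (rule real_le_rsqrt) simp
  then have nonneg: "0 \<le> w - a" "0 \<le> w - d"
    by (auto simp: w)
  have "(w - a) * (w - d) = (s\<^sup>2 - (a - d)\<^sup>2) / 4"
    by (simp add: w power2_eq_square field_simps)
  \<comment> \<open>The characteristic equation; with both factors nonnegative it makes the next
    estimate an instance of the arithmetic-geometric mean inequality.\<close>
  then have "(w - a) * (w - d) = e\<^sup>2"
    unfolding s2 by simp
  then have "sqrt (w - a) * sqrt (w - d) = \<bar>e\<bar>"
    by (simp only: real_sqrt_mult[symmetric] real_sqrt_abs)
  then have "2 * \<bar>e\<bar> * \<bar>p * q\<bar> \<le> (w - a) * p\<^sup>2 + (w - d) * q\<^sup>2"
    using sum_squares_bound[of "sqrt (w - a) * \<bar>p\<bar>" "sqrt (w - d) * \<bar>q\<bar>"] nonneg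
    by (simp add: power_mult_distrib abs_mult algebra_simps)
  moreover have "e * (p * q) \<le> \<bar>e\<bar> * \<bar>p * q\<bar>"
    by (simp flip: abs_mult)
  ultimately show ?thesis by (simp add: algebra_simps)
qed

context
  fixes A :: "'a::chilbert_space \<Rightarrow> 'a" and a d :: real
  assumes pos: "positive_op A" and ad: "0 \<le> a" "0 \<le> d"
begin

text \<open>The form of the block operator \<open>M\<close> is dominated by a real quadratic form in
  the seminorms of the two components. Its mixed coefficient is \<open>b + c\<close>, so only this
  sum enters the bound.\<close>

lemma A_spectral_radius_sum_le_sum:
  assumes bdd: "A_bounded A T1" "A_bounded A S1" "A_bounded A T2" "A_bounded A S2"
    and a: "\<And>x. cmod (A_inner A (S1 (T1 x)) x) \<le> a * (A_norm A x)\<^sup>2"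
    and d: "\<And>x. cmod (A_inner A (S2 (T2 x)) x) \<le> d * (A_norm A x)\<^sup>2"
    and b: "\<And>x. A_norm A (S1 (T2 x)) \<le> b * A_norm A x"
    and c: "\<And>x. A_norm A (S2 (T1 x)) \<le> c * A_norm A x"
  shows "A_spectral_radius A (\<lambda>x. T1 (S1 x) + T2 (S2 x))
      \<le> (a + d + sqrt ((a - d)\<^sup>2 + (b + c)\<^sup>2)) / 2"
proof -
  let ?B = "map_prod A A"
  \<comment> \<open>Symmetrising the off-diagonal entries leaves the quadratic form
    unchanged.\<close>
  define e where "e = (b + c) / 2"
  define w where "w = (a + d + sqrt ((a - d)\<^sup>2 + 4 * e\<^sup>2)) / 2"
  define V where "V z = T1 (fst z) + T2 (snd z)" for z
  define W where "W x = (S1 x, S2 x)" for x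
  define M where "M z = W (V z)" for z
  define R where "R x = T1 (S1 x) + T2 (S2 x)" for x
  have w0: "0 \<le> w" using ad by (simp add: w_def)
  have posB: "positive_op ?B" using pos by (simp add: positive_op_map_prod)
  have lin: "cbounded_linear T1" "cbounded_linear S1" "cbounded_linear T2" "cbounded_linear S2"
    using bdd by (auto simp: A_bounded_def)
  have "bounded_linear V"
    unfolding V_def using lin
    by (intro bounded_linear_add bounded_linear_compose[OF _ bounded_linear_fst]
        bounded_linear_compose[OF _ bounded_linear_snd]) (auto simp: cbounded_linear_def)
  moreover have "bounded_linear W"
    unfolding W_def using lin by (intro bounded_linear_Pair) (auto simp: cbounded_linear_def)
  ultimately have "bounded_linear M"
    unfolding M_def by (intro bounded_linear_compose[of W V])
  then have linM: "cbounded_linear M"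
    using lin by (simp add: cbounded_linear_def M_def W_def V_def scaleC_prod_def
        flip: scaleC_add_right)
  have num: "cmod (A_inner ?B (M z) z) \<le> w * (A_norm ?B z)\<^sup>2" for z
  proof -
    obtain x y where z: "z = (x, y)" by fastforce
    define p q where "p = A_norm A x" and "q = A_norm A y"
    have "0 \<le> p" "0 \<le> q" using pos by (auto simp: p_def q_def)
    have "A_inner ?B (M z) z = A_inner A (S1 (T1 x)) x + A_inner A (S1 (T2 y)) x
        + (A_inner A (S2 (T1 x)) y + A_inner A (S2 (T2 y)) y)"
      using lin by (simp add: z M_def W_def V_def A_inner_map_prod cbounded_linear_add
          A_inner_add_left[OF pos])
    also have "cmod \<dots> \<le> cmod (A_inner A (S1 (T1 x)) x) + cmod (A_inner A (S1 (T2 y)) x)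
        + (cmod (A_inner A (S2 (T1 x)) y) + cmod (A_inner A (S2 (T2 y)) y))"
      by (intro norm_triangle_mono order_refl)
    also have "\<dots> \<le> a * p\<^sup>2 + b * q * p + (c * p * q + d * q\<^sup>2)"
      using a[of x] d[of y] \<open>0 \<le> p\<close> \<open>0 \<le> q\<close>
        order_trans[OF A_Cauchy_Schwarz[OF pos] mult_right_mono[OF b[of y]], of x]
        order_trans[OF A_Cauchy_Schwarz[OF pos] mult_right_mono[OF c[of x]], of y]
      by (intro add_mono) (simp_all add: p_def q_def)
    also have "\<dots> = a * p\<^sup>2 + d * q\<^sup>2 + 2 * e * (p * q)"
      by (simp add: e_def algebra_simps)
    also have "\<dots> \<le> w * (p\<^sup>2 + q\<^sup>2)"
      unfolding w_def by (rule quadratic_form_le)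
    finally show ?thesis
      using pos by (simp add: z p_def q_def A_norm_map_prod)
  qed
  \<comment> \<open>Passing from the form back to the seminorm costs a factor 2, uniformly in
    \<open>k\<close>.\<close>
  have powM: "A_norm ?B ((M ^^ (2 ^ k)) z) \<le> 2 * w ^ (2 ^ k) * A_norm ?B z" for k z
    using w0
    by (intro A_norm_le_twice_numerical_bound[OF posB cbounded_linear_funpow[OF linM]]
        numerical_bound_dyadic_power[OF posB linM w0 num] zero_le_power)
  \<comment> \<open>\<open>R\<close> is \<open>V\<close> after \<open>W\<close> and \<open>M\<close>
    is \<open>W\<close> after \<open>V\<close>; regrouping the alternating product costs one
    power.\<close>
  have powR: "(R ^^ Suc n) x = V ((M ^^ n) (W x))" for n x
  proof (induction n arbitrary: x)
    case 0
    then show ?case by (simp add: R_def V_def W_def)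
  next
    case (Suc n)
    have "(R ^^ Suc (Suc n)) x = R ((R ^^ Suc n) x)" by simp
    also have "\<dots> = V ((M ^^ Suc n) (W x))"
      unfolding Suc.IH by (simp add: R_def V_def W_def M_def)
    finally show ?case .
  qed
  have "(A_norm A (fst z))\<^sup>2 \<le> (A_norm ?B z)\<^sup>2" "(A_norm A (snd z))\<^sup>2 \<le> (A_norm ?B z)\<^sup>2" for z
    unfolding A_norm_map_prod[OF pos pos] by simp_all
  then have comp: "A_norm A (fst z) \<le> A_norm ?B z" "A_norm A (snd z) \<le> A_norm ?B z" for z
    by (blast intro: power2_le_imp_le[OF _ A_norm_nonneg[OF posB]])+
  define n where "n = A_opnorm A"
  have n0: "0 \<le> n T1" "0 \<le> n T2" "0 \<le> n S1" "0 \<le> n S2"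
    using bdd A_opnorm_nonneg[OF pos] by (auto simp: n_def)
  have V: "A_norm A (V z) \<le> (n T1 + n T2) * A_norm ?B z" for z
  proof -
    have "A_norm A (V z) \<le> A_norm A (T1 (fst z)) + A_norm A (T2 (snd z))"
      unfolding V_def by (rule A_norm_triangle[OF pos])
    also have "\<dots> \<le> n T1 * A_norm A (fst z) + n T2 * A_norm A (snd z)"
      using bdd A_norm_le_A_opnorm[OF pos] by (intro add_mono) (auto simp: n_def)
    also have "\<dots> \<le> n T1 * A_norm ?B z + n T2 * A_norm ?B z"
      using n0 comp by (intro add_mono mult_left_mono)
    finally show ?thesis by (simp add: algebra_simps)
  qed
  have W: "A_norm ?B (W x) \<le> (n S1 + n S2) * A_norm A x" for x
  proof -
    have "A_norm ?B (W x) = sqrt ((A_norm ?B (W x))\<^sup>2)"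
      by (simp add: posB)
    also have "\<dots> = sqrt ((A_norm A (S1 x))\<^sup>2 + (A_norm A (S2 x))\<^sup>2)"
      by (simp only: A_norm_map_prod[OF pos pos] W_def fst_conv snd_conv)
    also have "\<dots> \<le> A_norm A (S1 x) + A_norm A (S2 x)"
      by (intro sqrt_sum_squares_le_sum A_norm_nonneg pos)
    also have "\<dots> \<le> n S1 * A_norm A x + n S2 * A_norm A x"
      using bdd A_norm_le_A_opnorm[OF pos] by (intro add_mono) (auto simp: n_def)
    finally show ?thesis by (simp add: distrib_right)
  qed
  \<comment> \<open>The constant collects the bounds of \<open>V\<close> and \<open>W\<close> and
    the factor 2, and is independent of \<open>k\<close>.\<close>
  have "A_spectral_radius A R \<le> w"
  proof (rule A_spectral_radius_le[OF pos _ w0, where C="(n T1 + n T2) * (2 * (n S1 + n S2))"])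
    show "A_bounded A R"
      unfolding R_def
      by (rule A_bounded_add[OF pos A_bounded_compose[OF pos bdd(1,2)] A_bounded_compose[OF pos bdd(3,4)]])
    show "0 \<le> (n T1 + n T2) * (2 * (n S1 + n S2))"
      using n0 by simp
    fix k x
    have "A_norm A ((R ^^ Suc (2 ^ k)) x) \<le> (n T1 + n T2) * A_norm ?B ((M ^^ (2 ^ k)) (W x))"
      unfolding powR by (rule V)
    also have "\<dots> \<le> (n T1 + n T2) * (2 * w ^ (2 ^ k) * A_norm ?B (W x))"
      using n0 powM by (intro mult_left_mono) auto
    also have "\<dots> \<le> (n T1 + n T2) * (2 * w ^ (2 ^ k) * ((n S1 + n S2) * A_norm A x))"
      using n0 w0 W by (intro mult_left_mono) auto
    finally show "A_norm A ((R ^^ Suc (2 ^ k)) x)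
        \<le> (n T1 + n T2) * (2 * (n S1 + n S2)) * w ^ (2 ^ k) * A_norm A x"
      by (simp only: mult_ac)
  qed
  then show ?thesis
    by (simp add: R_def[abs_def] w_def e_def power_divide)
qed

text \<open>Scaling \<open>T1\<close> by \<open>t\<close> and \<open>S1\<close> by
  \<open>1 / t\<close> preserves the sum and the diagonal blocks, but changes the off-diagonal
  bounds to \<open>b / t\<close> and \<open>t * c\<close>. Balancing them replaces
  \<open>b + c\<close> by twice the geometric mean. Adding \<epsilon> to both bounds covers
  vanishing \<open>b\<close> or \<open>c\<close>.\<close>

lemma A_spectral_radius_sum_le:
  assumes bdd: "A_bounded A T1" "A_bounded A S1" "A_bounded A T2" "A_bounded A S2"
    and a: "\<And>x. cmod (A_inner A (S1 (T1 x)) x) \<le> a * (A_norm A x)\<^sup>2"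
    and d: "\<And>x. cmod (A_inner A (S2 (T2 x)) x) \<le> d * (A_norm A x)\<^sup>2"
    and b: "0 \<le> b" "\<And>x. A_norm A (S1 (T2 x)) \<le> b * A_norm A x"
    and c: "0 \<le> c" "\<And>x. A_norm A (S2 (T1 x)) \<le> c * A_norm A x"
  shows "A_spectral_radius A (\<lambda>x. T1 (S1 x) + T2 (S2 x))
      \<le> (a + d + sqrt ((a - d)\<^sup>2 + 4 * (b * c))) / 2"
    (is "?r \<le> _")
proof -
  have lin: "cbounded_linear T1" "cbounded_linear S1" "cbounded_linear S2"
    using bdd by (auto simp: A_bounded_def)
  have "?r \<le> (a + d + sqrt ((a - d)\<^sup>2 + 4 * ((b + \<epsilon>) * (c + \<epsilon>)))) / 2" if "0 < \<epsilon>" for \<epsilon>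
  proof -
    \<comment> \<open>With this \<open>t\<close> both off-diagonal bounds equal the geometric mean
      of \<open>b + \<epsilon>\<close> and \<open>c + \<epsilon>\<close>.\<close>
    define t where "t = sqrt ((b + \<epsilon>) / (c + \<epsilon>))"
    have bc: "0 < b + \<epsilon>" "0 < c + \<epsilon>" using that b c by auto
    then have t: "0 < t" "t * t = (b + \<epsilon>) / (c + \<epsilon>)" by (auto simp: t_def)
    let ?t = "complex_of_real t" and ?s = "complex_of_real (1 / t)"
    have cancel: "?s *\<^sub>C ?t *\<^sub>C x = x" "?t *\<^sub>C ?s *\<^sub>C x = x" for x :: 'a
      using t by (simp_all add: scaleC_scaleC scaleC_one)
    have b': "A_norm A (S1 (T2 x)) \<le> (b + \<epsilon>) * A_norm A x"
      and c': "A_norm A (S2 (T1 x)) \<le> (c + \<epsilon>) * A_norm A x" for x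
      using order_trans[OF b(2) mult_right_mono] order_trans[OF c(2) mult_right_mono] that pos
      by simp_all
    have "A_spectral_radius A (\<lambda>x. ?t *\<^sub>C T1 (?s *\<^sub>C S1 x) + T2 (S2 x))
        \<le> (a + d + sqrt ((a - d)\<^sup>2 + ((b + \<epsilon>) / t + t * (c + \<epsilon>))\<^sup>2)) / 2"
    proof (rule A_spectral_radius_sum_le_sum[where ?T1.0="\<lambda>x. ?t *\<^sub>C T1 x"
          and ?S1.0="\<lambda>x. ?s *\<^sub>C S1 x" and ?T2.0=T2 and ?S2.0=S2])
      show "A_bounded A (\<lambda>x. ?t *\<^sub>C T1 x)" "A_bounded A (\<lambda>x. ?s *\<^sub>C S1 x)"
        using A_bounded_scaled[OF pos] bdd by auto
      show "cmod (A_inner A (?s *\<^sub>C S1 (?t *\<^sub>C T1 x)) x) \<le> a * (A_norm A x)\<^sup>2" for x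
        using a[of x] lin by (simp add: cbounded_linear_scaleC cancel del: of_real_divide)
      show "A_norm A (?s *\<^sub>C S1 (T2 x)) \<le> (b + \<epsilon>) / t * A_norm A x" for x
        using b'[of x] t by (simp add: A_norm_scaleC[OF pos] norm_divide divide_right_mono)
      show "A_norm A (S2 (?t *\<^sub>C T1 x)) \<le> t * (c + \<epsilon>) * A_norm A x" for x
        using c'[of x] t lin
        by (simp add: A_norm_scaleC[OF pos] cbounded_linear_scaleC mult.assoc)
    qed (use bdd d in auto)
    moreover have "(\<lambda>x. ?t *\<^sub>C T1 (?s *\<^sub>C S1 x) + T2 (S2 x)) = (\<lambda>x. T1 (S1 x) + T2 (S2 x))"
      using lin by (simp add: cbounded_linear_scaleC cancel del: of_real_divide)
    moreover have "((b + \<epsilon>) / t + t * (c + \<epsilon>))\<^sup>2 = 4 * ((b + \<epsilon>) * (c + \<epsilon>))"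
    proof -
      have "t * (c + \<epsilon>) = (b + \<epsilon>) / t"
        using t bc by (simp add: field_simps)
      then have "((b + \<epsilon>) / t + t * (c + \<epsilon>))\<^sup>2 = 4 * ((b + \<epsilon>) / t * (t * (c + \<epsilon>)))"
        by (simp add: power2_eq_square algebra_simps)
      then show ?thesis using t(1) by simp
    qed
    ultimately show ?thesis by simp
  qed
  \<comment> \<open>The bound is continuous in \<epsilon>, so letting \<epsilon> tend to 0 from the
    right removes the perturbation.\<close>
  then have "eventually (\<lambda>\<epsilon>. ?r \<le> (a + d + sqrt ((a - d)\<^sup>2 + 4 * ((b + \<epsilon>) * (c + \<epsilon>)))) / 2)
      (at_right 0)"
    by (intro eventually_mono[OF eventually_at_right_less])
  moreover have "((\<lambda>\<epsilon>. (a + d + sqrt ((a - d)\<^sup>2 + 4 * ((b + \<epsilon>) * (c + \<epsilon>)))) / 2)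
      \<longlongrightarrow> (a + d + sqrt ((a - d)\<^sup>2 + 4 * ((b + 0) * (c + 0)))) / 2) (at_right 0)"
    by (intro tendsto_intros) auto
  ultimately have "?r \<le> (a + d + sqrt ((a - d)\<^sup>2 + 4 * ((b + 0) * (c + 0)))) / 2"
    by (intro tendsto_lowerbound[OF _ _ trivial_limit_at_right_real])
  then show ?thesis by simp
qed

end

section \<open>Two factorisations of the product and the minimum of their bounds\<close>

theorem corollary2p4:
  fixes A T S :: "'a::chilbert_space \<Rightarrow> 'a"
  assumes "positive_op A" and "A_bounded A T" and "A_bounded A S"
  shows "A_spectral_radius A (T \<circ> S) \<le>
    1 / 4 * (A_numerical_radius A (T \<circ> S) + A_numerical_radius A (S \<circ> T)
      + sqrt ((A_numerical_radius A (T \<circ> S) - A_numerical_radius A (S \<circ> T))\<^sup>2 + 4 * nu A T S))"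
proof -
  note pos = assms(1)
  \<comment> \<open>The factor one half is put into the operators \<open>T1\<close> and
    \<open>T2\<close>, so that the sum is the product of \<open>T\<close> and \<open>S\<close>
    itself and no homogeneity of the spectral radius has to be invoked.\<close>
  let ?h = "complex_of_real (1 / 2)"
  let ?wTS = "A_numerical_radius A (T \<circ> S)" and ?wST = "A_numerical_radius A (S \<circ> T)"
  have lin: "cbounded_linear T" "cbounded_linear S"
    using assms by (auto simp: A_bounded_def)
  note TS = A_bounded_compose[OF pos assms(2,3)] and ST = A_bounded_compose[OF pos assms(3,2)]
  have bdd: "A_bounded A (T \<circ> S)" "A_bounded A (S \<circ> T)" "A_bounded A (S \<circ> T \<circ> S)"
      "A_bounded A (T \<circ> S \<circ> T)" "A_bounded A (\<lambda>x. ?h *\<^sub>C T x)" "A_bounded A (\<lambda>x. ?h *\<^sub>C T (S x))"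
      "A_bounded A (\<lambda>x. T (S x))" "A_bounded A (\<lambda>x. ?h *\<^sub>C x)" "A_bounded A (\<lambda>x. x)"
    using TS ST A_bounded_compose[OF pos ST assms(3)] A_bounded_compose[OF pos TS assms(2)]
      A_bounded_scaled[OF pos assms(2)] A_bounded_scaled[OF pos TS]
      A_bounded_scaled[OF pos A_bounded_id[OF pos]] A_bounded_id[OF pos]
    by (simp_all only: comp_def)
  note nonneg = A_opnorm_nonneg[OF pos assms(2)] A_opnorm_nonneg[OF pos assms(3)]
    A_opnorm_nonneg[OF pos bdd(3)] A_opnorm_nonneg[OF pos bdd(4)]
    A_numerical_radius_nonneg[OF pos bdd(1)] A_numerical_radius_nonneg[OF pos bdd(2)]
  have half: "?h *\<^sub>C x + ?h *\<^sub>C x = x" for x :: 'a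
    by (simp flip: scaleC_add_left add: scaleC_one)
  have numST: "cmod (A_inner A (S (?h *\<^sub>C T x)) x) \<le> ?wST / 2 * (A_norm A x)\<^sup>2" for x
    using A_inner_le_A_numerical_radius[OF pos bdd(2), of x] lin
    by (simp add: cbounded_linear_scaleC A_inner_scaleC_left[OF pos] norm_mult norm_divide)
  have numTS: "cmod (A_inner A (?h *\<^sub>C T (S x)) x) \<le> ?wTS / 2 * (A_norm A x)\<^sup>2" for x
    using A_inner_le_A_numerical_radius[OF pos bdd(1), of x]
    by (simp add: A_inner_scaleC_left[OF pos] norm_mult norm_divide)
  have halve: "(?wST / 2 + ?wTS / 2 + sqrt ((?wST / 2 - ?wTS / 2)\<^sup>2 + 4 * (m / 2 * (n / 2)))) / 2
      = 1 / 4 * (?wTS + ?wST + sqrt ((?wTS - ?wST)\<^sup>2 + 4 * (m * n)))" for m n :: real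
  proof -
    have "(?wST / 2 - ?wTS / 2)\<^sup>2 + 4 * (m / 2 * (n / 2)) = ((?wTS - ?wST)\<^sup>2 + 4 * (m * n)) / 4"
      by (simp add: power2_eq_square field_simps)
    then show ?thesis by (simp only: real_sqrt_divide real_sqrt_four) simp
  qed
  \<comment> \<open>In this factorisation the off-diagonal blocks are half of
    \<open>S \<circ> T \<circ> S\<close> and half of \<open>T\<close>; the diagonal blocks are half
    of \<open>S \<circ> T\<close> and of \<open>T \<circ> S\<close>.\<close>
  have "A_spectral_radius A (\<lambda>x. ?h *\<^sub>C T (S x) + ?h *\<^sub>C T (S x))
      \<le> (?wST / 2 + ?wTS / 2 + sqrt ((?wST / 2 - ?wTS / 2)\<^sup>2
          + 4 * (A_opnorm A (S \<circ> T \<circ> S) / 2 * (A_opnorm A T / 2)))) / 2"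
  proof (rule A_spectral_radius_sum_le[where ?T1.0="\<lambda>x. ?h *\<^sub>C T x" and ?S1.0=S
        and ?T2.0="\<lambda>x. ?h *\<^sub>C T (S x)" and ?S2.0="\<lambda>x. x"])
    show "A_norm A (S (?h *\<^sub>C T (S x))) \<le> A_opnorm A (S \<circ> T \<circ> S) / 2 * A_norm A x" for x
      using A_norm_le_A_opnorm[OF pos bdd(3), of x] lin
      by (simp add: cbounded_linear_scaleC A_norm_scaleC[OF pos] norm_divide)
    show "A_norm A (?h *\<^sub>C T x) \<le> A_opnorm A T / 2 * A_norm A x" for x
      using A_norm_le_A_opnorm[OF pos assms(2), of x]
      by (simp add: A_norm_scaleC[OF pos] norm_divide)
  qed (use pos assms(2,3) nonneg bdd numST numTS in auto)
  then have 1: "A_spectral_radius A (T \<circ> S) \<le> 1 / 4 * (?wTS + ?wST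
      + sqrt ((?wTS - ?wST)\<^sup>2 + 4 * (A_opnorm A (S \<circ> T \<circ> S) * A_opnorm A T)))"
    unfolding halve half by (simp add: comp_def)
  \<comment> \<open>Moving \<open>T \<circ> S\<close> to the other factor of the second summand
    keeps the diagonal blocks and makes the off-diagonal ones half of \<open>S\<close> and half of
    \<open>T \<circ> S \<circ> T\<close>.\<close>
  have "A_spectral_radius A (\<lambda>x. ?h *\<^sub>C T (S x) + ?h *\<^sub>C T (S x))
      \<le> (?wST / 2 + ?wTS / 2 + sqrt ((?wST / 2 - ?wTS / 2)\<^sup>2
          + 4 * (A_opnorm A S / 2 * (A_opnorm A (T \<circ> S \<circ> T) / 2)))) / 2"
  proof (rule A_spectral_radius_sum_le[where ?T1.0="\<lambda>x. ?h *\<^sub>C T x" and ?S1.0=S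
        and ?T2.0="\<lambda>x. ?h *\<^sub>C x" and ?S2.0="\<lambda>x. T (S x)"])
    show "A_norm A (S (?h *\<^sub>C x)) \<le> A_opnorm A S / 2 * A_norm A x" for x
      using A_norm_le_A_opnorm[OF pos assms(3), of x] lin
      by (simp add: cbounded_linear_scaleC A_norm_scaleC[OF pos] norm_divide)
    show "A_norm A (T (S (?h *\<^sub>C T x))) \<le> A_opnorm A (T \<circ> S \<circ> T) / 2 * A_norm A x" for x
      using A_norm_le_A_opnorm[OF pos bdd(4), of x] lin
      by (simp add: cbounded_linear_scaleC A_norm_scaleC[OF pos] norm_divide)
  qed (use pos assms(2,3) nonneg bdd numST numTS lin in \<open>auto simp: cbounded_linear_scaleC\<close>)
  then have 2: "A_spectral_radius A (T \<circ> S) \<le> 1 / 4 * (?wTS + ?wST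
      + sqrt ((?wTS - ?wST)\<^sup>2 + 4 * (A_opnorm A S * A_opnorm A (T \<circ> S \<circ> T))))"
    unfolding halve half by (simp add: comp_def)
  \<comment> \<open>Whichever product attains the minimum in \<open>nu\<close>, one of the two
    bounds is the claim.\<close>
  show ?thesis
    using 1 2 by (simp add: nu_def min_def mult.commute)
qed

end
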